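(* There are no integers $x,y,z$ with $\gcd(x,y)=1$ satisfying $7x^2+y^8=4z^3$. *)

theory Defs
  imports "HOL-Number_Theory.Number_Theory"
begin

end

theory Submission
  imports Defs "HOL-Computational_Algebra.Nth_Powers"
begin

text \<open>
  In a solution \<open>x\<close> and \<open>y\<close> are odd, and \<open>(y\<^sup>4 + x \<surd>-7) / 2\<close> is coprime to its conjugate.
  The ring of integers of \<open>\<rat>(\<surd>-7)\<close> is Euclidean with units \<open>\<plusminus>1\<close>, so this number is a cube
  \<open>((a + b \<surd>-7) / 2)\<^sup>3\<close>; hence \<open>4 y\<^sup>4 = a (a\<^sup>2 - 21 b\<^sup>2)\<close> with \<open>a, b\<close> odd and coprime.

  If \<open>3\<close> does not divide \<open>a\<close>, then \<open>s\<^sup>8 - 4 t\<^sup>4 = 21 b\<^sup>2\<close>. The factors \<open>s\<^sup>4 \<plusminus> 2 t\<^sup>2\<close> are coprime and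
  the one with the plus sign is divisible by \<open>3\<close>, so the other is a square or \<open>7\<close> times a square
  although it is \<open>2\<close> modulo \<open>3\<close>.

  Otherwise \<open>243 s\<^sup>8 + 4 t\<^sup>4 = 7 b\<^sup>2\<close>. Parametrising the conic \<open>3 X\<^sup>2 + Y\<^sup>2 = 7 b\<^sup>2\<close> at \<open>X = 9 s\<^sup>4\<close>,
  \<open>Y = 2 t\<^sup>2\<close> gives \<open>t\<^sup>2 = p\<^sup>2 - 3 p q - 3 q\<^sup>2\<close> and \<open>9 s\<^sup>4 = p\<^sup>2 + 4 p q - 3 q\<^sup>2\<close> with \<open>8\<close> dividing \<open>q\<close>.
  The second equation is \<open>(p + 2 q)\<^sup>2 = (3 s\<^sup>2)\<^sup>2 + 7 q\<^sup>2\<close>, so that \<open>q = \<plusminus>2 m n\<close> and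
  \<open>3 s\<^sup>2 = \<plusminus>(m\<^sup>2 - 7 n\<^sup>2)\<close>, which is impossible modulo \<open>8\<close>.
\<close>

section \<open>The integers of \<open>\<rat>(\<surd>-7)\<close>\<close>

text \<open>This is a root of \<open>X^2 - X + 2\<close>. Since -7 is 1 mod 4, it is this element,
  rather than the square root of -7, that spans the ring of integers together with 1.\<close>

definition omega7 :: complex where
  "omega7 = Complex (1 / 2) (sqrt 7 / 2)"

definition ints7 :: "complex set" where
  "ints7 = {of_int a + of_int b * omega7 | a b. True}"

lemma omega7_square: "omega7 * omega7 = omega7 - 2"
  by (simp add: omega7_def complex_eq_iff field_simps)

lemma ints7I: "z = of_int a + of_int b * omega7 \<Longrightarrow> z \<in> ints7"
  unfolding ints7_def by blast

lemma ints7E: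
  assumes "z \<in> ints7"
  obtains a b where "z = of_int a + of_int b * omega7"
  using assms unfolding ints7_def by blast

lemma of_int_in_ints7 [simp]: "of_int n \<in> ints7"
  by (rule ints7I[of _ n 0]) simp

lemma zero_in_ints7 [simp]: "0 \<in> ints7" and one_in_ints7 [simp]: "1 \<in> ints7"
  using of_int_in_ints7[of 0] of_int_in_ints7[of 1] by simp_all

lemma add_in_ints7 [simp]:
  assumes "z \<in> ints7" "w \<in> ints7" shows "z + w \<in> ints7"
proof -
  obtain a b c d where "z = of_int a + of_int b * omega7" "w = of_int c + of_int d * omega7"
    using assms by (metis ints7E)
  then show ?thesis by (intro ints7I[of _ "a + c" "b + d"]) (simp add: algebra_simps)
qed

lemma mult_in_ints7 [simp]:
  assumes "z \<in> ints7" "w \<in> ints7" shows "z * w \<in> ints7"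
proof -
  obtain a b c d where zw: "z = of_int a + of_int b * omega7" "w = of_int c + of_int d * omega7"
    using assms by (metis ints7E)
  have "z * w = of_int (a * c) + of_int (a * d + b * c) * omega7
      + of_int (b * d) * (omega7 * omega7)"
    unfolding zw by (simp add: algebra_simps)
  also have "\<dots> = of_int (a * c - 2 * b * d) + of_int (a * d + b * c + b * d) * omega7"
    unfolding omega7_square by (simp add: algebra_simps)
  finally show ?thesis by (rule ints7I)
qed

lemma uminus_in_ints7 [simp]: "z \<in> ints7 \<Longrightarrow> - z \<in> ints7"
  using mult_in_ints7[of "of_int (-1)" z] of_int_in_ints7[of "-1"] by simp

lemma diff_in_ints7 [simp]: "z \<in> ints7 \<Longrightarrow> w \<in> ints7 \<Longrightarrow> z - w \<in> ints7"
  using add_in_ints7[of z "- w"] by simp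

lemma power_in_ints7 [simp]: "z \<in> ints7 \<Longrightarrow> z ^ n \<in> ints7"
  by (induction n) simp_all

section \<open>Norm, units and division with remainder\<close>

lemma cmod_ints7: "(cmod (of_int a + of_int b * omega7))\<^sup>2 = of_int (a\<^sup>2 + a * b + 2 * b\<^sup>2)"
  unfolding cmod_power2 omega7_def by (simp add: power2_eq_square field_simps)

lemma cmod_power2_in_Ints: "z \<in> ints7 \<Longrightarrow> (cmod z)\<^sup>2 \<in> \<int>"
  by (metis ints7E cmod_ints7 Ints_of_int)

text \<open>The norms of \<open>u\<close> and \<open>v\<close> are integers with product 1, and
  norms are nonnegative, so \<open>M = 1\<close>; then
  \<open>4 * M = (2 * a + b)^2 + 7 * b^2\<close> forces \<open>b = 0\<close>.\<close>

lemma ints7_unit: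
  assumes "u \<in> ints7" "v \<in> ints7" "u * v = 1"
  shows "u = 1 \<or> u = -1"
proof -
  obtain a b where u: "u = of_int a + of_int b * omega7" using assms by (metis ints7E)
  obtain c d where v: "v = of_int c + of_int d * omega7" using assms by (metis ints7E)
  define M N where "M = a\<^sup>2 + a * b + 2 * b\<^sup>2" and "N = c\<^sup>2 + c * d + 2 * d\<^sup>2"
  have "(cmod u)\<^sup>2 * (cmod v)\<^sup>2 = 1"
    using assms(3) by (metis norm_mult norm_one power_mult_distrib power_one)
  then have "real_of_int (M * N) = 1" unfolding u v cmod_ints7 M_def N_def by simp
  then have MN: "M * N = 1" by linarith
  have M4: "4 * M = (2 * a + b)\<^sup>2 + 7 * b\<^sup>2"
    unfolding M_def by (simp add: power2_eq_square algebra_simps)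
  then have "M \<ge> 0" using zero_le_power2[of "2 * a + b"] zero_le_power2[of b] by linarith
  with MN have M1: "M = 1" by (metis zmult_eq_1_iff le_minus_one_simps(3))
  have "b = 0"
  proof (rule ccontr)
    assume "b \<noteq> 0"
    then have "b\<^sup>2 \<ge> 1" using zero_less_power2[of b] by linarith
    then show False using M4 M1 zero_le_power2[of "2 * a + b"] by linarith
  qed
  with M1 have "a\<^sup>2 = 1" unfolding M_def by simp
  then have "a = 1 \<or> a = -1" by (simp add: power2_eq_1_iff)
  with \<open>b = 0\<close> u show ?thesis by auto
qed

text \<open>Rounding first the coordinate along \<open>omega7\<close>, then the real coordinate that
  remains, leaves a squared error of at most 1/4 + (7/4)(1/4) = 11/16.\<close>

lemma ints7_approx: "\<exists>q \<in> ints7. cmod (z - q) < 1"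
proof -
  define t where "t = 2 * Im z / sqrt 7"
  define b where "b = round t"
  define a where "a = round (Re z - b / 2)"
  define q where "q = of_int a + of_int b * omega7"
  have Imz: "Im z = t * sqrt 7 / 2" by (simp add: t_def)
  have "\<bar>t - b\<bar> \<le> 1 / 2" unfolding b_def using of_int_round_abs_le[of t] by (simp add: abs_minus_commute)
  then have 1: "(t - b)\<^sup>2 \<le> 1 / 4" using abs_le_square_iff[of "t - b" "1 / 2"]
    by (simp add: power2_eq_square)
  have "\<bar>Re z - b / 2 - a\<bar> \<le> 1 / 2" unfolding a_def
    using of_int_round_abs_le[of "Re z - b / 2"] by (simp add: abs_minus_commute)
  then have 2: "(Re z - b / 2 - a)\<^sup>2 \<le> 1 / 4"
    using abs_le_square_iff[of "Re z - b / 2 - a" "1 / 2"] by (simp add: power2_eq_square)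
  have re: "Re (z - q) = Re z - b / 2 - a" by (simp add: q_def omega7_def)
  have im: "Im (z - q) = (t - b) * (sqrt 7 / 2)"
    by (simp add: q_def omega7_def Imz algebra_simps)
  have "(Im (z - q))\<^sup>2 = (t - b)\<^sup>2 * (7 / 4)"
    unfolding im power_mult_distrib by (simp add: power_divide)
  then have "(cmod (z - q))\<^sup>2 < 1\<^sup>2" unfolding cmod_power2 re using 1 2 by simp
  then have "cmod (z - q) < 1" by (rule power_less_imp_less_base) simp
  then show ?thesis by (intro bexI[of _ q]) (auto simp: q_def ints7I)
qed

lemma ints7_division:
  assumes "w \<noteq> 0"
  shows "\<exists>q \<in> ints7. cmod (z - q * w) < cmod w"
proof -
  obtain q where q: "q \<in> ints7" "cmod (z / w - q) < 1" using ints7_approx by blast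
  have "z - q * w = (z / w - q) * w" using assms by (simp add: field_simps)
  then have "cmod (z - q * w) = cmod (z / w - q) * cmod w" by (simp add: norm_mult)
  also have "\<dots> < cmod w" using q assms by simp
  finally show ?thesis using q by blast
qed

text \<open>A nonzero element \<open>d\<close> of least norm in the ideal \<open>S\<close> generated
  by \<open>x\<close> and \<open>y\<close> divides all of \<open>S\<close>, because a nonzero
  remainder would be smaller.\<close>

lemma ints7_bezout:
  assumes "x \<in> ints7" "y \<in> ints7" "x \<noteq> 0"
  obtains u v g h where "u \<in> ints7" "v \<in> ints7" "g \<in> ints7" "h \<in> ints7"
    "x = g * (u * x + v * y)" "y = h * (u * x + v * y)"
proof -
  define S where "S = {u * x + v * y | u v. u \<in> ints7 \<and> v \<in> ints7}"
  \<comment> \<open>Squared moduli on the ring are integers, so the floor loses nothing there and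
    yields a measure in the naturals.\<close>
  define f where "f z = nat \<lfloor>(cmod z)\<^sup>2\<rfloor>" for z
  have S_ints: "z \<in> ints7" if "z \<in> S" for z using that assms unfolding S_def by auto
  have xS: "x \<in> S" unfolding S_def
    by (rule CollectI, intro exI[of _ 1] exI[of _ 0]) simp
  have yS: "y \<in> S" unfolding S_def
    by (rule CollectI, intro exI[of _ 0] exI[of _ 1]) simp
  have "\<exists>d. (d \<in> S \<and> d \<noteq> 0) \<and> (\<forall>z. z \<in> S \<and> z \<noteq> 0 \<longrightarrow> f d \<le> f z)"
    using xS assms(3) by (intro ex_has_least_nat[of _ x]) auto
  then obtain d where d: "d \<in> S" "d \<noteq> 0" and min: "\<And>z. z \<in> S \<Longrightarrow> z \<noteq> 0 \<Longrightarrow> f d \<le> f z"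
    by blast
  from d obtain u v where uv: "u \<in> ints7" "v \<in> ints7" "d = u * x + v * y"
    unfolding S_def by blast
  have dvd: "\<exists>g \<in> ints7. z = g * d" if z: "z \<in> S" for z
  proof -
    obtain q where q: "q \<in> ints7" "cmod (z - q * d) < cmod d"
      using ints7_division[OF d(2)] by blast
    obtain u' v' where u'v': "u' \<in> ints7" "v' \<in> ints7" "z = u' * x + v' * y"
      using z unfolding S_def by blast
    have "z - q * d = (u' - q * u) * x + (v' - q * v) * y"
      unfolding u'v' uv by (simp add: algebra_simps)
    moreover have "u' - q * u \<in> ints7" "v' - q * v \<in> ints7" using u'v' uv q by simp_all
    ultimately have rS: "z - q * d \<in> S" unfolding S_def by blast
    obtain m n where mn: "(cmod d)\<^sup>2 = of_int m" "(cmod (z - q * d))\<^sup>2 = of_int n"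
      using cmod_power2_in_Ints[OF S_ints] rS d(1) by (metis Ints_cases)
    have "(cmod (z - q * d))\<^sup>2 < (cmod d)\<^sup>2" using q by (intro power_strict_mono) auto
    moreover have "(cmod (z - q * d))\<^sup>2 \<ge> 0" by simp
    ultimately have "n < m" "n \<ge> 0" unfolding mn by simp_all
    then have "f (z - q * d) < f d" unfolding f_def mn by simp
    then have "z - q * d = 0" using min[OF rS] by (meson not_le)
    then show ?thesis using q by auto
  qed
  obtain g h where gh: "g \<in> ints7" "h \<in> ints7" "x = g * d" "y = h * d"
    using dvd[OF xS] dvd[OF yS] by blast
  show ?thesis using that[OF uv(1,2) gh(1,2)] gh(3,4) unfolding uv(3) by blast
qed

section \<open>Coprime factors of a cube\<close>

text \<open>If \<open>\<delta>\<close> generates the ideal \<open>(\<alpha>, \<zeta>)\<close>, then \<open>\<delta>\<^sup>3\<close> and \<open>\<alpha>\<close> divide each other.\<close>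
lemma ints7_coprime_cube:
  assumes "\<alpha> \<in> ints7" "\<beta> \<in> ints7" "\<zeta> \<in> ints7" "r \<in> ints7" "s \<in> ints7"
    and prod: "\<alpha> * \<beta> = \<zeta> ^ 3" and cop: "r * \<alpha> + s * \<beta> = 1" and "\<alpha> \<noteq> 0"
  shows "\<exists>\<delta> \<in> ints7. \<alpha> = \<delta> ^ 3"
proof -
  obtain u v g h where uv: "u \<in> ints7" "v \<in> ints7" "g \<in> ints7" "h \<in> ints7"
    and g: "\<alpha> = g * (u * \<alpha> + v * \<zeta>)" and h: "\<zeta> = h * (u * \<alpha> + v * \<zeta>)"
    using ints7_bezout[of \<alpha> \<zeta>] assms by metis
  define \<delta> where "\<delta> = u * \<alpha> + v * \<zeta>"
  note g = g[folded \<delta>_def] and h = h[folded \<delta>_def]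
  \<comment> \<open>These are the cofactors in \<open>\<delta> ^ 3 = k * \<alpha>\<close> and
    \<open>\<alpha> = l * \<delta> ^ 3\<close>. So both are units, and the sign \<plusminus>1 is
    itself a cube.\<close>
  define k where "k = u ^ 3 * \<alpha>\<^sup>2 + 3 * u\<^sup>2 * \<alpha> * v * \<zeta> + 3 * u * v\<^sup>2 * \<zeta>\<^sup>2 + v ^ 3 * \<beta>"
  define l where "l = r\<^sup>2 * g ^ 3 + 2 * r * s * \<alpha> * h ^ 3 + s\<^sup>2 * \<beta> * h ^ 3"
  have three: "3 \<in> ints7" and two: "2 \<in> ints7"
    using of_int_in_ints7[of 3] of_int_in_ints7[of 2] by simp_all
  have k: "k \<in> ints7" and l: "l \<in> ints7" unfolding k_def l_def using uv assms three two by simp_all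
  have d: "\<delta> \<in> ints7" unfolding \<delta>_def using uv assms by simp
  have "\<delta> ^ 3 = u ^ 3 * \<alpha> ^ 3 + 3 * u\<^sup>2 * \<alpha>\<^sup>2 * v * \<zeta> + 3 * u * \<alpha> * v\<^sup>2 * \<zeta>\<^sup>2 + v ^ 3 * \<zeta> ^ 3"
    unfolding \<delta>_def by (simp add: power2_eq_square power3_eq_cube algebra_simps)
  also have "\<dots> = k * \<alpha>" unfolding prod[symmetric] k_def
    by (simp add: power2_eq_square power3_eq_cube algebra_simps)
  finally have 1: "\<delta> ^ 3 = k * \<alpha>" .
  have g3: "\<alpha> ^ 3 = g ^ 3 * \<delta> ^ 3" by (metis g power_mult_distrib)
  have h3: "\<alpha> * \<beta> = h ^ 3 * \<delta> ^ 3" unfolding prod by (metis h power_mult_distrib)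
  \<comment> \<open>Squaring the Bezout identity makes every term a multiple of \<alpha>^3 or
    \<alpha>\<beta>, both known multiples of \<delta>^3; the first power would leave a term in
    \<alpha>^2.\<close>
  have "\<alpha> = \<alpha> * (r * \<alpha> + s * \<beta>)\<^sup>2" unfolding cop by simp
  also have "\<dots> = r\<^sup>2 * \<alpha> ^ 3 + 2 * r * s * \<alpha> * (\<alpha> * \<beta>) + s\<^sup>2 * \<beta> * (\<alpha> * \<beta>)"
    by (simp add: power2_eq_square power3_eq_cube algebra_simps)
  also have "\<dots> = l * \<delta> ^ 3" unfolding g3 h3 l_def by (simp add: algebra_simps)
  finally have 2: "\<alpha> = l * \<delta> ^ 3" .
  have "l * k = 1" using 1 2 \<open>\<alpha> \<noteq> 0\<close> by (metis mult.assoc mult_cancel_right1)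
  then have "l = 1 \<or> l = -1" using ints7_unit k l by blast
  then show ?thesis
  proof
    assume "l = 1" then show ?thesis using 2 d by (intro bexI[of _ \<delta>]) simp_all
  next
    assume "l = -1" then show ?thesis using 2 d by (intro bexI[of _ "- \<delta>"]) simp_all
  qed
qed

text \<open>For odd \<open>A\<close>, \<open>B\<close> the number \<alpha> = (A + B\<rho>)/2 lies in
  the ring and is coprime to its conjugate, so it is a cube \<delta>^3. With \<delta> = (a +
  b\<rho>)/2 the two equations compare coordinates in 8\<alpha> = (2\<delta>)^3.\<close>

lemma square_plus_7_square_eq_4_cube:
  fixes A B z :: int
  assumes eq: "A\<^sup>2 + 7 * B\<^sup>2 = 4 * z ^ 3" and odd: "odd A" "odd B"
    and cop: "coprime A (7 * B)"
  shows "\<exists>a b. 4 * A = a * (a\<^sup>2 - 21 * b\<^sup>2) \<and> 4 * B = b * (3 * a\<^sup>2 - 7 * b\<^sup>2) \<and> even (a - b)"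
proof -
  define \<rho> where "\<rho> = Complex 0 (sqrt 7)"
  have \<rho>2: "\<rho> * \<rho> = -7" by (simp add: \<rho>_def complex_eq_iff)
  have \<rho>: "\<rho> = of_int (-1) + of_int 2 * omega7" by (simp add: \<rho>_def omega7_def complex_eq_iff)
  have \<rho>_in: "\<rho> \<in> ints7" using \<rho> by (rule ints7I)
  define \<alpha> \<beta> where "\<alpha> = (of_int A + of_int B * \<rho>) / 2" and "\<beta> = (of_int A - of_int B * \<rho>) / 2"
  have "even (A - B)" using odd by simp
  then obtain c where "A - B = 2 * c" by (rule evenE)
  then have c: "A = B + 2 * c" by simp
  have \<alpha>: "\<alpha> \<in> ints7" by (rule ints7I[of _ c B]) (simp add: \<alpha>_def \<rho> c field_simps)
  have \<beta>: "\<beta> \<in> ints7" by (rule ints7I[of _ "c + B" "- B"]) (simp add: \<beta>_def \<rho> c field_simps)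
  have "4 * (\<alpha> * \<beta>) = of_int (A\<^sup>2) - of_int (B\<^sup>2) * (\<rho> * \<rho>)"
    unfolding \<alpha>_def \<beta>_def by (simp add: power2_eq_square field_simps)
  also have "\<dots> = of_int (A\<^sup>2 + 7 * B\<^sup>2)" unfolding \<rho>2 by simp
  also have "\<dots> = 4 * of_int z ^ 3" unfolding eq by simp
  finally have prod: "\<alpha> * \<beta> = of_int z ^ 3" by simp
  obtain m n where mn: "m * A + n * (7 * B) = 1"
    using cop by (metis bezout_int coprime_imp_gcd_eq_1)
  \<comment> \<open>Chosen so that the terms in \<rho> cancel and
    \<open>r * \<alpha> + s * \<beta>\<close> becomes \<open>m * A + n * (7 * B)\<close>.\<close>
  define r s where "r = of_int m - of_int n * \<rho>" and "s = of_int m + of_int n * \<rho>"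
  have rs: "r \<in> ints7" "s \<in> ints7" unfolding r_def s_def using \<rho>_in by simp_all
  have "r * \<alpha> + s * \<beta> = of_int m * of_int A - of_int n * of_int B * (\<rho> * \<rho>)"
    unfolding r_def s_def \<alpha>_def \<beta>_def by (simp add: field_simps)
  also have "\<dots> = of_int (m * A + n * (7 * B))" unfolding \<rho>2 by simp
  finally have bez: "r * \<alpha> + s * \<beta> = 1" unfolding mn by simp
  have "\<alpha> \<noteq> 0" using odd(1) by (auto simp: \<alpha>_def \<rho>_def complex_eq_iff)
  then obtain \<delta> where \<delta>: "\<delta> \<in> ints7" "\<alpha> = \<delta> ^ 3"
    using ints7_coprime_cube[OF \<alpha> \<beta> _ rs prod bez] by auto
  then obtain e b where eb: "\<delta> = of_int e + of_int b * omega7" by (metis ints7E)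
  define a where "a = 2 * e + b"
  have "2 * \<delta> = of_int a + of_int b * \<rho>" unfolding eb a_def \<rho> by (simp add: algebra_simps)
  moreover have eight: "(2 :: complex) ^ 3 = 8" by simp
  ultimately have "8 * \<alpha> = (of_int a + of_int b * \<rho>) ^ 3" unfolding \<delta>(2)
    by (metis eight power_mult_distrib)
  also have "\<dots> = of_int (a ^ 3) + 3 * of_int (a\<^sup>2 * b) * \<rho> + 3 * of_int (a * b\<^sup>2) * (\<rho> * \<rho>)
      + of_int (b ^ 3) * (\<rho> * \<rho>) * \<rho>"
    by (simp add: power2_eq_square power3_eq_cube algebra_simps)
  also have "\<dots> = of_int (a * (a\<^sup>2 - 21 * b\<^sup>2)) + of_int (b * (3 * a\<^sup>2 - 7 * b\<^sup>2)) * \<rho>"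
    unfolding \<rho>2 by (simp add: power2_eq_square power3_eq_cube algebra_simps)
  finally have "8 * \<alpha> = of_int (a * (a\<^sup>2 - 21 * b\<^sup>2)) + of_int (b * (3 * a\<^sup>2 - 7 * b\<^sup>2)) * \<rho>" .
  moreover have "8 * \<alpha> = of_int (4 * A) + of_int (4 * B) * \<rho>" by (simp add: \<alpha>_def)
  ultimately have *: "of_int (4 * A) + of_int (4 * B) * \<rho>
      = of_int (a * (a\<^sup>2 - 21 * b\<^sup>2)) + of_int (b * (3 * a\<^sup>2 - 7 * b\<^sup>2)) * \<rho>"
    by metis
  have inj: "i = k \<and> j = l"
    if "of_int i + of_int j * \<rho> = of_int k + of_int l * \<rho>" for i j k l :: int
    using that by (simp add: \<rho>_def complex_eq_iff)
  have "even (a - b)" unfolding a_def by simp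
  then show ?thesis using inj[OF *] by blast
qed

section \<open>Products of coprime integers\<close>

lemma coprime_mult_eq_power:
  fixes a b c :: int
  assumes "coprime a b" "a * b = c ^ n" "a \<ge> 0" "b \<ge> 0"
  shows "\<exists>u v. a = u ^ n \<and> b = v ^ n"
proof -
  have "coprime (nat a) (nat b)" using assms by (metis coprime_int_iff nat_0_le)
  moreover have "nat a * nat b = (nat \<bar>c\<bar>) ^ n"
    using assms by (metis abs_mult abs_of_nonneg nat_mult_distrib nat_power_eq power_abs abs_ge_zero)
  ultimately have "is_nth_power n (nat a)" "is_nth_power n (nat b)"
    using is_nth_power_mult_coprime_nat_iff by (metis is_nth_power_nth_power)+
  then obtain u v where "nat a = u ^ n" "nat b = v ^ n" by (metis is_nth_powerE)
  then have "a = int u ^ n" "b = int v ^ n" using assms by (metis nat_0_le of_nat_power)+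
  then show ?thesis by blast
qed

text \<open>The prime divides one factor; cancelling it leaves coprime nonnegative numbers whose
  product is a square.\<close>

lemma coprime_mult_eq_prime_mult_square:
  fixes a b c p :: int
  assumes "prime p" and cop: "coprime a b" and eq: "a * b = p * c\<^sup>2" and "a \<ge> 0" "b \<ge> 0"
  shows "\<exists>u v. (a = p * u\<^sup>2 \<and> b = v\<^sup>2) \<or> (a = v\<^sup>2 \<and> b = p * u\<^sup>2)"
proof -
  have p: "p > 0" using \<open>prime p\<close> by (simp add: prime_gt_0_int)
  have *: "\<exists>u v. a = p * u\<^sup>2 \<and> b = v\<^sup>2"
    if "p dvd a" "coprime a b" "a * b = p * c\<^sup>2" "a \<ge> 0" "b \<ge> 0" for a b :: int
  proof -
    obtain k where k: "a = p * k" using \<open>p dvd a\<close> by (rule dvdE)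
    then have "coprime k b" "k * b = c\<^sup>2" "k \<ge> 0"
      using that p by (auto simp: zero_le_mult_iff)
    then show ?thesis using coprime_mult_eq_power[of k b c 2] that k by blast
  qed
  have "p dvd a \<or> p dvd b" using \<open>prime p\<close> eq by (metis dvd_triv_left prime_dvd_mult_iff)
  then show ?thesis
    using *[of a b] *[of b a] assms by (metis coprime_commute mult.commute)
qed

text \<open>The halves (P - Q)/2 and (P + Q)/2 are coprime and nonnegative with product
  \<open>r * w^2\<close>. The sign \<open>e\<close> records which of them carries the prime
  \<open>r\<close>.\<close>

lemma square_eq_square_plus_prime_mult_square:
  fixes P Q w r :: int
  assumes r: "prime r" and eq: "P\<^sup>2 = Q\<^sup>2 + r * (2 * w)\<^sup>2"
    and "P \<ge> 0" "odd P" and cop: "coprime P Q"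
  shows "\<exists>m n e. w = e * m * n \<and> Q = e * (m\<^sup>2 - r * n\<^sup>2) \<and> (e = 1 \<or> e = -1)"
proof -
  have "even (P\<^sup>2) \<longleftrightarrow> even (Q\<^sup>2)" unfolding eq by simp
  then have "odd Q" using \<open>odd P\<close> by simp
  then have "even (P - Q)" using \<open>odd P\<close> by simp
  then obtain F where F: "P - Q = 2 * F" by (rule evenE)
  define G where "G = P - F"
  have PQ: "P = F + G" "Q = G - F" using F by (simp_all add: G_def)
  have FG: "F * G = r * w\<^sup>2" using eq unfolding PQ by (simp add: power2_eq_square algebra_simps)
  have "Q\<^sup>2 \<le> P\<^sup>2" using eq r prime_gt_0_int[of r] by simp
  then have "\<bar>Q\<bar> \<le> P" using \<open>P \<ge> 0\<close> by (metis abs_le_square_iff abs_of_nonneg)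
  then have "F \<ge> 0" "G \<ge> 0" unfolding PQ by linarith+
  moreover have "coprime F G"
  proof (rule coprimeI)
    fix d assume "d dvd F" "d dvd G"
    then have "d dvd P" "d dvd Q" unfolding PQ by simp_all
    with cop show "is_unit d" by (rule coprime_common_divisor)
  qed
  ultimately obtain n m where nm: "(F = r * n\<^sup>2 \<and> G = m\<^sup>2) \<or> (F = m\<^sup>2 \<and> G = r * n\<^sup>2)"
    using coprime_mult_eq_prime_mult_square[OF r _ FG] by blast
  then have "r * (m * n)\<^sup>2 = r * w\<^sup>2"
    using FG by (auto simp: power_mult_distrib algebra_simps)
  then have "(m * n)\<^sup>2 = w\<^sup>2" using r by auto
  then have w: "w = m * n \<or> w = - (m * n)" by (metis power2_eq_iff)
  from nm obtain e :: int where e: "Q = e * (m\<^sup>2 - r * n\<^sup>2)" "e = 1 \<or> e = -1"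
    unfolding PQ by force
  \<comment> \<open>Replacing \<open>n\<close> by \<open>- n\<close> adjusts the sign of
    \<open>w\<close> and leaves \<open>Q\<close> unchanged.\<close>
  from w e(2) have "w = e * m * n \<or> w = e * m * (- n)" by auto
  then show ?thesis using e by (metis power2_minus)
qed

section \<open>Two equations without solutions\<close>

lemma coprime_power_2_odd:
  fixes d :: int
  assumes "odd d"
  shows "coprime (2 ^ n) d"
  using assms by (simp add: coprime_power_left_iff)

lemma square_mod_3:
  fixes x :: int
  shows "x\<^sup>2 mod 3 = (if 3 dvd x then 0 else 1)"
proof -
  have "x mod 3 = 0 \<or> x mod 3 = 1 \<or> x mod 3 = 2" by presburger
  then show ?thesis
    by (auto simp: power_mod[of x 3 2, symmetric] dvd_eq_mod_eq_0)
qed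

lemma odd_square_mod_8:
  fixes x :: int
  assumes "odd x"
  shows "x\<^sup>2 mod 8 = 1"
proof -
  have "x mod 8 = 1 \<or> x mod 8 = 3 \<or> x mod 8 = 5 \<or> x mod 8 = 7" using assms by presburger
  then show ?thesis by (auto simp: power_mod[of x 8 2, symmetric])
qed

text \<open>This settles the case where 3 does not divide \<open>a\<close>, with
  \<open>S = s^4\<close>. The smaller factor \<open>F\<close> is 2 mod 3, while \<open>u^2\<close>
  and \<open>7 * u^2\<close> are 0 or 1.\<close>

lemma square_minus_four_fourth_power_ne_21_square:
  fixes S t b :: int
  assumes eq: "S\<^sup>2 - 4 * t ^ 4 = 21 * b\<^sup>2" and S: "odd S" "S \<ge> 0" "S mod 3 = 1"
    and cop: "coprime S t" and "b \<noteq> 0"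
  shows False
proof -
  define F G where "F = S - 2 * t\<^sup>2" and "G = S + 2 * t\<^sup>2"
  have FG: "F * G = 21 * b\<^sup>2" unfolding eq[symmetric] F_def G_def
    by (simp add: power2_eq_square power4_eq_xxxx algebra_simps)
  have "F * G > 0" unfolding FG using \<open>b \<noteq> 0\<close> by simp
  moreover have "G \<ge> 0" unfolding G_def using S by simp
  ultimately have pos: "F > 0" "G > 0" by (auto simp: zero_less_mult_iff)
  have copFG: "coprime F G"
  proof (rule coprimeI)
    fix d assume d: "d dvd F" "d dvd G"
    have "odd F" unfolding F_def using S by simp
    then have "odd d" using d(1) dvd_trans by blast
    then have d4: "coprime d (2 ^ 2)" and d2: "coprime d 2"
      using coprime_power_2_odd[of d 2] coprime_commute[of d] by simp_all
    have "d dvd G - F" "d dvd G + F" using d by simp_all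
    then have "d dvd 2 ^ 2 * t\<^sup>2" "d dvd 2 * S" by (simp_all add: F_def G_def)
    then have "d dvd t\<^sup>2" "d dvd S" using d4 d2 coprime_dvd_mult_right_iff by blast+
    moreover have "coprime S (t\<^sup>2)" using cop by simp
    ultimately show "is_unit d" using coprime_common_divisor by blast
  qed
  have "t\<^sup>2 mod 3 = 1"
  proof (rule ccontr)
    assume "t\<^sup>2 mod 3 \<noteq> 1"
    then have "3 dvd t" using square_mod_3[of t] by (auto split: if_splits)
    then have "3 dvd 4 * t ^ 4 + 21 * b\<^sup>2" by (simp add: power4_eq_xxxx)
    also have "4 * t ^ 4 + 21 * b\<^sup>2 = S\<^sup>2" using eq by simp
    finally show False using square_mod_3[of S] S by (simp add: dvd_eq_mod_eq_0)
  qed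
  then have Fm: "F mod 3 = 2" and "G mod 3 = 0" unfolding F_def G_def using S by presburger+
  then obtain H where H: "G = 3 * H" by auto
  have "F * H = 7 * b\<^sup>2" "H \<ge> 0" "coprime F H" using FG pos copFG unfolding H by simp_all
  moreover have "prime (7 :: int)" by simp
  ultimately obtain u where "F = 7 * u\<^sup>2 \<or> F = u\<^sup>2"
    using coprime_mult_eq_prime_mult_square[of 7 F H b] pos(1) by (metis less_imp_le)
  moreover have "u\<^sup>2 mod 3 = 0 \<or> u\<^sup>2 mod 3 = 1" by (simp add: square_mod_3)
  moreover have "7 * u\<^sup>2 mod 3 = u\<^sup>2 mod 3" by presburger
  ultimately show False using Fm by auto
qed

text \<open>Since 7 = 2^2 + 3, for a suitable sign \<open>d\<close> the number Y + dX sqrt(-3) is (2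
  + sqrt(-3)) (U + V sqrt(-3)). Taking norms gives \<open>b^2 = U^2 + 3 * V^2\<close>, which the
  preceding parametrisation solves.\<close>

lemma three_square_plus_square_eq_7_square:
  fixes X Y b :: int
  assumes eq: "3 * X\<^sup>2 + Y\<^sup>2 = 7 * b\<^sup>2" and cop: "coprime X Y" and Y: "even Y" "\<not> 3 dvd Y"
    and b: "odd b"
  shows "\<exists>p q e d. Y = 2 * e * (p\<^sup>2 - 3 * p * q - 3 * q\<^sup>2) \<and> X = d * e * (p\<^sup>2 + 4 * p * q - 3 * q\<^sup>2)
    \<and> (e = 1 \<or> e = -1) \<and> (d = 1 \<or> d = -1)"
proof -
  have p7: "prime (7 :: int)" by simp
  have p3: "prime (3 :: int)" by simp
  \<comment> \<open>As 4X^2 - Y^2 = 7X^2 - 7b^2, the prime 7 divides 2X - Y or 2X + Y;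
    \<open>d\<close> selects the sign.\<close>
  have "7 * (X\<^sup>2 - b\<^sup>2) = (2 * X - Y) * (2 * X + Y)"
    using eq by (simp add: power2_eq_square algebra_simps)
  then have "7 dvd (2 * X - Y) * (2 * X + Y)" by (metis dvd_triv_left)
  then have "7 dvd 2 * X - Y \<or> 7 dvd 2 * X + Y" using p7 by (simp add: prime_dvd_mult_iff)
  then have "\<exists>d. (d = 1 \<or> d = -1) \<and> 7 dvd 2 * (d * X) - Y"
  proof
    assume "7 dvd 2 * X - Y" then show ?thesis by (intro exI[of _ 1]) simp
  next
    assume "7 dvd 2 * X + Y"
    moreover have "2 * (- 1 * X) - Y = - (2 * X + Y)" by simp
    ultimately show ?thesis by (intro exI[of _ "-1"]) (metis dvd_minus_iff)
  qed
  then obtain d V where d: "d = 1 \<or> d = -1" and V: "2 * (d * X) - Y = 7 * V" by (metis dvdE)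
  define U where "U = d * X - 2 * V"
  have YU: "Y = 2 * U - 3 * V" and dX: "d * X = U + 2 * V" using V by (simp_all add: U_def)
  have XU: "X = d * (U + 2 * V)" unfolding dX[symmetric] using d by auto
  have "X\<^sup>2 = (U + 2 * V)\<^sup>2" unfolding dX[symmetric] using d by auto
  with eq have bb: "b\<^sup>2 = U\<^sup>2 + 3 * V\<^sup>2" unfolding YU by (simp add: power2_eq_square algebra_simps)
  have "even V" using Y(1) unfolding YU by simp
  then obtain W where W: "V = 2 * W" by blast
  have "coprime U V"
  proof (rule coprimeI)
    fix c assume "c dvd U" "c dvd V"
    then have "c dvd X" "c dvd Y" unfolding XU YU by simp_all
    with cop show "is_unit c" by (rule coprime_common_divisor)
  qed
  moreover have "coprime U 3"
  proof -
    have "\<not> 3 dvd U" using Y(2) unfolding YU by (auto simp: dvd_diff)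
    then show ?thesis using p3 by (metis coprime_commute prime_imp_coprime)
  qed
  ultimately have "coprime U (3 * V\<^sup>2)" by simp
  then have "coprime U (U * U + 3 * V\<^sup>2)" by (metis coprime_iff_gcd_eq_1 gcd_add_mult add.commute)
  then have "coprime U (b\<^sup>2)" unfolding bb by (simp add: power2_eq_square)
  then have "coprime \<bar>b\<bar> U" by (simp add: coprime_commute)
  moreover have "\<bar>b\<bar>\<^sup>2 = U\<^sup>2 + 3 * (2 * W)\<^sup>2" using bb W by simp
  moreover have "odd \<bar>b\<bar>" using b by simp
  ultimately obtain p q e where W': "W = e * p * q" and U': "U = e * (p\<^sup>2 - 3 * q\<^sup>2)"
    and e: "e = 1 \<or> e = -1"
    using square_eq_square_plus_prime_mult_square[OF p3, of "\<bar>b\<bar>" U W] by auto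
  have "Y = 2 * e * (p\<^sup>2 - 3 * p * q - 3 * q\<^sup>2)"
    unfolding YU W W' U' by (simp add: algebra_simps)
  moreover have "X = d * e * (p\<^sup>2 + 4 * p * q - 3 * q\<^sup>2)"
    unfolding XU W W' U' by (simp add: algebra_simps)
  ultimately show ?thesis using d e by blast
qed

lemma eighth_power_243_plus_four_fourth_power_ne_7_square:
  fixes s t b :: int
  assumes eq: "243 * s ^ 8 + 4 * t ^ 4 = 7 * b\<^sup>2" and odd: "odd s" "odd t" "odd b"
    and t: "\<not> 3 dvd t" and s: "\<not> 7 dvd s" and cop: "coprime s t"
  shows False
proof -
  have p3: "prime (3 :: int)" and p7: "prime (7 :: int)" by simp_all
  have "3 * (9 * s ^ 4)\<^sup>2 + (2 * t\<^sup>2)\<^sup>2 = 7 * b\<^sup>2" unfolding eq[symmetric]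
    by (simp add: power_mult_distrib flip: power_mult)
  moreover have "coprime (9 * s ^ 4) (2 * t\<^sup>2)"
  proof -
    have "coprime 3 t" using t p3 by (rule prime_imp_coprime[rotated])
    then have "coprime (3 * 3) t" by (simp only: coprime_mult_left_iff)
    then have "coprime 9 t" by simp
    moreover have "coprime (9 * s ^ 4) 2" using odd by simp
    ultimately show ?thesis using cop by simp
  qed
  moreover have "even (2 * t\<^sup>2)" by simp
  moreover have "\<not> 3 dvd 2 * t\<^sup>2" using square_mod_3[of t] t by presburger
  ultimately obtain p q e d where e: "e = 1 \<or> e = -1" and d: "d = 1 \<or> d = -1"
    and t2': "2 * t\<^sup>2 = 2 * e * (p\<^sup>2 - 3 * p * q - 3 * q\<^sup>2)"
    and s4': "9 * s ^ 4 = d * e * (p\<^sup>2 + 4 * p * q - 3 * q\<^sup>2)"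
    using three_square_plus_square_eq_7_square odd(3) by metis
  \<comment> \<open>Modulo 3 the equation reads t^2 = e p^2, which rules out
    \<open>e = -1\<close>.\<close>
  have "t\<^sup>2 mod 3 = 1" using t by (simp add: square_mod_3)
  moreover have "p\<^sup>2 mod 3 = 0 \<or> p\<^sup>2 mod 3 = 1" by (simp add: square_mod_3)
  moreover have "t\<^sup>2 = e * p\<^sup>2 - 3 * (e * (p * q + q\<^sup>2))" using t2' by (simp add: algebra_simps)
  ultimately have e1: "e = 1" using e by (elim disjE[of "e = 1"]) (simp, hypsubst, presburger)
  have t2: "t\<^sup>2 = p\<^sup>2 - 3 * p * q - 3 * q\<^sup>2" using t2' e1 by simp
  have s4: "9 * s ^ 4 = d * (p\<^sup>2 + 4 * p * q - 3 * q\<^sup>2)" using s4' e1 by simp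
  have t8: "t\<^sup>2 mod 8 = 1" using odd by (simp add: odd_square_mod_8)
  have s8: "s ^ 4 mod 8 = 1" using odd_square_mod_8[of "s\<^sup>2"] odd by simp
  \<comment> \<open>The left side is 1 mod 8, so a cofactor of the sign \<open>d\<close> is
    congruent to \<open>d\<close>. This will exclude even \<open>p\<close> and later fix
    \<open>d\<close>.\<close>
  have d_mod: "T mod 8 = d mod 8" if "9 * s ^ 4 = d * T" for T
  proof -
    define N where "N = 9 * s ^ 4"
    have "N mod 8 = (9 * (s ^ 4 mod 8)) mod 8" unfolding N_def by (simp only: mod_mult_right_eq)
    then have N: "N mod 8 = 1" unfolding s8 by simp
    from d show ?thesis
    proof
      assume "d = 1"
      then show ?thesis using that N by (simp add: N_def)
    next
      assume d: "d = -1"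
      then have "T = - N" using that by (simp add: N_def)
      then have "T mod 8 = 7" using N by presburger
      then show ?thesis using d by simp
    qed
  qed
  have "coprime p q"
  proof (rule coprimeI)
    fix c assume c: "c dvd p" "c dvd q"
    then obtain p' q' where "p = c * p'" "q = c * q'" by (auto elim!: dvdE)
    then have "t\<^sup>2 = c * (p' * p - 3 * p' * q - 3 * q' * q)"
        "9 * s ^ 4 = c * (d * (p' * p + 4 * p' * q - 3 * q' * q))"
      unfolding t2 s4 by (simp_all add: power2_eq_square algebra_simps)
    then have "c dvd 2 * t\<^sup>2" "c dvd 9 * s ^ 4" by simp_all
    then show "is_unit c" using \<open>coprime (9 * s ^ 4) (2 * t\<^sup>2)\<close> coprime_common_divisor by blast
  qed
  \<comment> \<open>If \<open>p\<close> is even, then \<open>q\<close> is odd and the equation for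
    t^2 mod 8 forces 4 to divide \<open>p\<close>. Then p^2 + 4pq - 3q^2 is 5 mod 8, which is not
    \<plusminus>1.\<close>
  have "odd p"
  proof
    assume "even p"
    then obtain k where k: "p = 2 * k" by blast
    have "odd q" using \<open>coprime p q\<close> \<open>even p\<close> by (metis coprime_common_divisor odd_one)
    then have q8: "q\<^sup>2 mod 8 = 1" by (rule odd_square_mod_8)
    have "t\<^sup>2 = 4 * k\<^sup>2 - 6 * (k * q) - 3 * q\<^sup>2" unfolding t2 k by (simp add: power2_eq_square)
    then have "even x" if "x = k * q" for x using t8 q8 unfolding that[symmetric] by presburger
    then have "even (k * q)" by blast
    then have "even k" using \<open>odd q\<close> by simp
    then obtain l where l: "k = 2 * l" by blast
    have "9 * s ^ 4 = d * (- 3 * q\<^sup>2 + 8 * (2 * l\<^sup>2 + 2 * (l * q)))"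
      unfolding s4 k l by (simp add: power2_eq_square algebra_simps)
    then have "(- 3 * q\<^sup>2 + 8 * (2 * l\<^sup>2 + 2 * (l * q))) mod 8 = d mod 8" by (rule d_mod)
    then have "(- 3 * q\<^sup>2) mod 8 = d mod 8" by (simp only: mod_mult_self2)
    then have "(- 3 * (q\<^sup>2 mod 8)) mod 8 = d mod 8" by (simp only: mod_mult_right_eq)
    then show False using d unfolding q8 by auto
  qed
  then have p8: "p\<^sup>2 mod 8 = 1" by (rule odd_square_mod_8)
  have "odd (p + q)"
  proof
    assume "even (p + q)"
    then have "odd q" using \<open>odd p\<close> by simp
    then have "even (9 * s ^ 4)" unfolding s4 using \<open>odd p\<close> by simp
    then show False using odd by simp
  qed
  \<comment> \<open>Here p^2 - t^2 = 3(p + q)q is divisible by 8 and \<open>p + q\<close> is odd, so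
    8 divides \<open>q\<close>.\<close>
  have "8 dvd p\<^sup>2 - t\<^sup>2" using p8 t8 by presburger
  also have "p\<^sup>2 - t\<^sup>2 = 3 * (p + q) * q" unfolding t2 by (simp add: power2_eq_square algebra_simps)
  finally have "2 ^ 3 dvd 3 * (p + q) * q" by simp
  moreover have "coprime (2 ^ 3) (3 * (p + q))"
    using \<open>odd (p + q)\<close> by (intro coprime_power_2_odd) simp
  ultimately have "2 ^ 3 dvd q" using coprime_dvd_mult_right_iff by blast
  then obtain h where h: "q = 8 * h" by auto
  have "9 * s ^ 4 = d * (p\<^sup>2 + 8 * (4 * p * h - 24 * h\<^sup>2))"
    unfolding s4 h by (simp add: power2_eq_square algebra_simps)
  then have "(p\<^sup>2 + 8 * (4 * p * h - 24 * h\<^sup>2)) mod 8 = d mod 8" by (rule d_mod)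
  then have "d = 1" using d unfolding mod_mult_self2 p8 by auto
  \<comment> \<open>Completing the square: P^2 = (p^2 + 4pq - 3q^2) + 7q^2, and q = 2(4h) has the
    shape needed for the prime 7.\<close>
  define P where "P = p + 2 * q"
  have PP: "\<bar>P\<bar>\<^sup>2 = (3 * s\<^sup>2)\<^sup>2 + 7 * (2 * (4 * h))\<^sup>2"
  proof -
    have "P\<^sup>2 = (p\<^sup>2 + 4 * p * q - 3 * q\<^sup>2) + 7 * q\<^sup>2" unfolding P_def
      by (simp add: power2_eq_square algebra_simps)
    also have "p\<^sup>2 + 4 * p * q - 3 * q\<^sup>2 = (3 * s\<^sup>2)\<^sup>2" using s4 \<open>d = 1\<close> by (simp add: power_mult_distrib)
    finally show ?thesis by (simp add: h)
  qed
  moreover have "coprime \<bar>P\<bar> (3 * s\<^sup>2)"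
  proof -
    have "coprime P q" unfolding P_def using \<open>coprime p q\<close>
      by (metis coprime_iff_gcd_eq_1 gcd_add_mult gcd.commute add.commute mult.commute)
    moreover have "coprime P 7"
    proof -
      have "\<not> 7 dvd P"
      proof
        assume "7 dvd P"
        then have "7 dvd \<bar>P\<bar>\<^sup>2 - 7 * (2 * (4 * h))\<^sup>2" by (simp add: power2_eq_square)
        then have "7 dvd (3 * s\<^sup>2)\<^sup>2" unfolding PP by simp
        then have "7 dvd 3 * s\<^sup>2" using p7 prime_dvd_power by blast
        then have "7 dvd s\<^sup>2" by presburger
        then show False using s p7 prime_dvd_power by blast
      qed
      then show ?thesis using p7 by (metis coprime_commute prime_imp_coprime)
    qed
    ultimately have *: "coprime P (7 * q\<^sup>2)" by simp
    show ?thesis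
    proof (rule coprimeI)
      fix c assume c: "c dvd \<bar>P\<bar>" "c dvd 3 * s\<^sup>2"
      then have "c dvd \<bar>P\<bar>\<^sup>2 - (3 * s\<^sup>2)\<^sup>2"
        by (intro dvd_diff) (simp_all only: power2_eq_square[of "3 * s\<^sup>2"] power2_eq_square[of "\<bar>P\<bar>"] dvd_mult)
      then have "c dvd 7 * q\<^sup>2" unfolding PP h by simp
      moreover have "c dvd P" using c by simp
      ultimately show "is_unit c" using * coprime_common_divisor by blast
    qed
  qed
  moreover have "odd \<bar>P\<bar>" unfolding P_def using \<open>odd p\<close> by simp
  ultimately obtain m n g where mn: "4 * h = g * m * n" and g: "g = 1 \<or> g = -1"
    and s2: "3 * s\<^sup>2 = g * (m\<^sup>2 - 7 * n\<^sup>2)"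
    using square_eq_square_plus_prime_mult_square[OF p7, of "\<bar>P\<bar>" "3 * s\<^sup>2" "4 * h"] by auto
  \<comment> \<open>Exactly one of \<open>m\<close>, \<open>n\<close> is even, so it is divisible by
    4. In both cases \<open>T\<close> is 1 mod 8, whereas 3s^2 is 3 mod 8 and equals
    \<plusminus>T.\<close>
  have "m * n = 4 * (g * h)" using mn g by auto
  then have mn4: "2 ^ 2 dvd m * n" by simp
  have "odd (3 * s\<^sup>2)" using odd by simp
  then have par: "odd m \<longleftrightarrow> even n" unfolding s2 using g by auto
  define T where "T = m\<^sup>2 - 7 * n\<^sup>2"
  have "T mod 8 = 1"
  proof (cases "odd m")
    case True
    then have "coprime (2 ^ 2) m" by (rule coprime_power_2_odd)
    then have "2 ^ 2 dvd n" using mn4 coprime_dvd_mult_right_iff by blast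
    then obtain k where "n = 4 * k" by auto
    then have "n\<^sup>2 = 8 * (2 * k\<^sup>2)" by (simp add: power2_eq_square)
    then show ?thesis using odd_square_mod_8[OF True] T_def by presburger
  next
    case False
    then have n: "odd n" using par by simp
    then have "coprime (2 ^ 2) n" by (rule coprime_power_2_odd)
    then have "2 ^ 2 dvd m" using mn4 coprime_dvd_mult_left_iff by blast
    then obtain k where "m = 4 * k" by auto
    then have "m\<^sup>2 = 8 * (2 * k\<^sup>2)" by (simp add: power2_eq_square)
    then show ?thesis using odd_square_mod_8[OF n] T_def by presburger
  qed
  moreover have "s\<^sup>2 mod 8 = 1" using odd by (simp add: odd_square_mod_8)
  moreover have "3 * s\<^sup>2 = T \<or> 3 * s\<^sup>2 = - T" using s2 g unfolding T_def by auto
  ultimately show False by presburger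
qed

section \<open>Reduction of the cubic equation to the two impossible equations\<close>

text \<open>A common divisor of \<open>a\<close> and a^2 - 21b^2 divides 21b^2, and 7 does not
  divide \<open>a\<close>, so only 3 matters. Once 4 and the powers of 3 are distributed, the
  coprime factors of y^4 are fourth powers up to sign.\<close>

lemma no_solution_of_odd_coprime_cubic:
  fixes a b y :: int
  assumes eq: "4 * y ^ 4 = a * (a\<^sup>2 - 21 * b\<^sup>2)" and odd: "odd a" "odd b" "odd y"
    and cop: "coprime a b" and y7: "\<not> 7 dvd y"
  shows False
proof -
  have p3: "prime (3 :: int)" and p7: "prime (7 :: int)" by simp_all
  have a7: "\<not> 7 dvd a"
  proof
    assume "7 dvd a"
    then have "7 dvd 4 * y ^ 4" unfolding eq by simp
    then have "7 dvd y ^ 4" by presburger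
    then show False using y7 p7 prime_dvd_power by blast
  qed
  have b0: "b \<noteq> 0" using odd by auto
  have sq: "a\<^sup>2 mod 8 = 1" "b\<^sup>2 mod 8 = 1" using odd by (simp_all add: odd_square_mod_8)
  show False
  proof (cases "3 dvd a")
    case False
    \<comment> \<open>Both squares are 1 mod 8, and 1 - 21 = -20 is divisible by 4.\<close>
    have "4 dvd a\<^sup>2 - 21 * b\<^sup>2" using sq by presburger
    then obtain M where M: "a\<^sup>2 - 21 * b\<^sup>2 = 4 * M" by blast
    have aM: "a * M = y ^ 4" using eq unfolding M by simp
    have "coprime a 3" "coprime a 7" using False a7 p3 p7 by (metis coprime_commute prime_imp_coprime)+
    then have "coprime a (3 * 7)" by (simp only: coprime_mult_right_iff)
    then have a21: "coprime a (21 * b\<^sup>2)" using cop by simp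
    have "coprime a M"
    proof (rule coprimeI)
      fix c assume c: "c dvd a" "c dvd M"
      then have "c dvd a\<^sup>2 - 4 * M" by (simp add: power2_eq_square)
      also have "a\<^sup>2 - 4 * M = 21 * b\<^sup>2" using M by simp
      finally show "is_unit c" using a21 c coprime_common_divisor by blast
    qed
    then have "coprime \<bar>a\<bar> \<bar>M\<bar>" by simp
    moreover have "\<bar>a\<bar> * \<bar>M\<bar> = y ^ 4" unfolding abs_mult[symmetric] aM by simp
    ultimately obtain s t where st: "\<bar>a\<bar> = s ^ 4" "\<bar>M\<bar> = t ^ 4"
      using coprime_mult_eq_power[of "\<bar>a\<bar>" "\<bar>M\<bar>" y 4] by auto
    have a2: "a\<^sup>2 = (s ^ 4)\<^sup>2" using st by (metis power2_abs)
    have "odd \<bar>a\<bar>" using odd by simp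
    have s3: "\<not> 3 dvd s"
    proof
      assume "3 dvd s"
      then have "3 dvd \<bar>a\<bar>" unfolding st by (simp add: power4_eq_xxxx)
      then show False using False by simp
    qed
    have fourth: "x ^ 4 = (x\<^sup>2)\<^sup>2" for x :: int by simp
    have "\<not> 3 dvd s\<^sup>2" using s3 p3 prime_dvd_power by blast
    then have s43: "s ^ 4 mod 3 = 1" unfolding fourth[of s] square_mod_3 by simp
    have "\<not> 3 dvd s ^ 4" using s43 by presburger
    then have s83: "(s ^ 4)\<^sup>2 mod 3 = 1" unfolding square_mod_3 by simp
    \<comment> \<open>A negative \<open>M\<close> would make t^4 congruent to 2 mod 3.\<close>
    have "M \<ge> 0"
    proof (rule ccontr)
      assume "\<not> M \<ge> 0"
      then have "(s ^ 4)\<^sup>2 - 21 * b\<^sup>2 = - 4 * t ^ 4" using M st a2 by simp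
      moreover have "t ^ 4 mod 3 = 0 \<or> t ^ 4 mod 3 = 1" unfolding fourth[of t] square_mod_3 by simp
      ultimately show False using s83 by presburger
    qed
    then have "(s ^ 4)\<^sup>2 - 4 * t ^ 4 = 21 * b\<^sup>2" using M st a2 by simp
    moreover have "coprime (s ^ 4) t"
    proof -
      have "coprime (s ^ 4) (t ^ 4)" using \<open>coprime \<bar>a\<bar> \<bar>M\<bar>\<close> unfolding st .
      then show ?thesis by simp
    qed
    moreover have "odd (s ^ 4)" "s ^ 4 \<ge> 0" using \<open>odd \<bar>a\<bar>\<close> unfolding st by simp_all
    ultimately show False using square_minus_four_fourth_power_ne_21_square s43 b0 by blast
  next
    case True
    then obtain c where c: "a = 3 * c" by blast
    have b3: "\<not> 3 dvd b" using True cop p3 by (metis coprime_common_divisor not_prime_unit)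
    have c8: "c\<^sup>2 mod 8 = 1" using odd unfolding c by (simp add: odd_square_mod_8)
    have "4 dvd 3 * c\<^sup>2 - 7 * b\<^sup>2" using sq c8 by presburger
    then obtain M where M: "3 * c\<^sup>2 - 7 * b\<^sup>2 = 4 * M" by blast
    have "4 * y ^ 4 = 9 * c * (3 * c\<^sup>2 - 7 * b\<^sup>2)" unfolding eq c
      by (simp add: power2_eq_square algebra_simps)
    then have cM: "9 * c * M = y ^ 4" unfolding M by simp
    have b23: "b\<^sup>2 mod 3 = 1" using b3 by (simp add: square_mod_3)
    \<comment> \<open>As \<open>M\<close> is prime to 3, the whole factor 9 stays with
      \<open>c\<close>: it is \<open>9 * c\<close> that is a fourth power up to sign.\<close>
    then have M3: "\<not> 3 dvd M" using M by presburger
    have "coprime c 7" using a7 p7 unfolding c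
      by (metis coprime_commute dvd_mult prime_imp_coprime)
    then have c7: "coprime c (7 * b\<^sup>2)" using cop unfolding c by simp
    have "coprime c M"
    proof (rule coprimeI)
      fix k assume k: "k dvd c" "k dvd M"
      then have "k dvd 3 * c\<^sup>2 - 4 * M" by (simp add: power2_eq_square)
      also have "3 * c\<^sup>2 - 4 * M = 7 * b\<^sup>2" using M by simp
      finally show "is_unit k" using c7 k coprime_common_divisor by blast
    qed
    moreover have "coprime (3 * 3) M" using prime_imp_coprime[OF p3 M3]
      by (simp only: coprime_mult_left_iff)
    ultimately have cop': "coprime \<bar>9 * c\<bar> \<bar>M\<bar>" by simp
    moreover have "\<bar>9 * c\<bar> * \<bar>M\<bar> = y ^ 4" unfolding abs_mult[symmetric] cM by simp
    ultimately obtain r t where rt: "\<bar>9 * c\<bar> = r ^ 4" "\<bar>M\<bar> = t ^ 4"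
      using coprime_mult_eq_power[of "\<bar>9 * c\<bar>" "\<bar>M\<bar>" y 4] by auto
    have "3 dvd r ^ 4" unfolding rt(1)[symmetric] by simp
    then have "3 dvd r" using p3 prime_dvd_power by blast
    then obtain s where s: "r = 3 * s" by blast
    have "9 * \<bar>c\<bar> = 81 * s ^ 4" using rt(1) unfolding s by (simp add: power_mult_distrib abs_mult)
    then have cs: "\<bar>c\<bar> = 9 * s ^ 4" by simp
    have "c\<^sup>2 = (9 * s ^ 4)\<^sup>2" using cs by (metis power2_abs)
    then have c2: "c\<^sup>2 = 81 * s ^ 8" by (simp add: power_mult_distrib)
    have t3: "\<not> 3 dvd t"
    proof
      assume "3 dvd t"
      then have "3 dvd \<bar>M\<bar>" unfolding rt by (simp add: power4_eq_xxxx)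
      then show False using M3 by simp
    qed
    then have "\<not> 3 dvd t\<^sup>2" using p3 prime_dvd_power by blast
    then have t43: "(t\<^sup>2)\<^sup>2 mod 3 = 1" unfolding square_mod_3 by simp
    \<comment> \<open>Otherwise 3c^2 - 7b^2, which is 2 mod 3, would equal 4t^4, which is 1.\<close>
    have "M < 0"
    proof (rule ccontr)
      assume "\<not> M < 0"
      then have "3 * c\<^sup>2 - 7 * b\<^sup>2 = 4 * (t\<^sup>2)\<^sup>2" using M rt by simp
      then show False using b23 t43 by presburger
    qed
    then have "243 * s ^ 8 + 4 * t ^ 4 = 7 * b\<^sup>2" using M rt c2 by simp
    moreover have "odd s" "odd t" "\<not> 7 dvd s"
    proof -
      have "odd \<bar>c\<bar>" using odd c by simp
      then show "odd s" unfolding cs by simp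
      have "odd (\<bar>9 * c\<bar> * \<bar>M\<bar>)" unfolding \<open>\<bar>9 * c\<bar> * \<bar>M\<bar> = y ^ 4\<close> using odd by simp
      then show "odd t" unfolding rt by simp
      show "\<not> 7 dvd s"
      proof
        assume "7 dvd s"
        then have "7 dvd \<bar>c\<bar>" unfolding cs by (simp add: power4_eq_xxxx)
        then show False using a7 c by simp
      qed
    qed
    moreover have "coprime s t"
    proof -
      have "coprime (r ^ 4) (t ^ 4)" using cop' unfolding rt .
      then show ?thesis unfolding s by simp
    qed
    ultimately show False
      using eighth_power_243_plus_four_fourth_power_ne_7_square odd(2) t3 by blast
  qed
qed

section \<open>From the original equation to the cubic\<close>

theorem theorem7:
  shows "\<not> (\<exists>x y z :: int. gcd x y = 1 \<and> 7 * x ^ 2 + y ^ 8 = 4 * z ^ 3)"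
proof
  assume "\<exists>x y z :: int. gcd x y = 1 \<and> 7 * x ^ 2 + y ^ 8 = 4 * z ^ 3"
  then obtain x y z :: int where "gcd x y = 1" and eq: "7 * x\<^sup>2 + y ^ 8 = 4 * z ^ 3" by metis
  then have cop: "coprime x y" by (simp add: coprime_iff_gcd_eq_1)
  have p7: "prime (7 :: int)" by simp
  have "even (7 * x\<^sup>2 + y ^ 8)" unfolding eq by simp
  then have "even x \<longleftrightarrow> even y" by simp
  then have x: "odd x" and y: "odd y" using cop by (metis coprime_common_divisor odd_one)+
  \<comment> \<open>If 7 divides \<open>y\<close>, it divides \<open>z\<close>; then 49 divides
    7x^2, so 7 divides \<open>x\<close> as well.\<close>
  have y7: "\<not> 7 dvd y"
  proof
    assume "7 dvd y"
    then obtain k where k: "y = 7 * k" by blast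
    have "7 dvd 7 * x\<^sup>2 + y ^ 8" using k by (simp add: power_mult_distrib)
    then have "7 dvd z ^ 3" unfolding eq by presburger
    then have "7 dvd z" using p7 prime_dvd_power by blast
    then obtain l where l: "z = 7 * l" by blast
    have "7 * x\<^sup>2 = 7 * (7 * (4 * 7 * l ^ 3 - 7 ^ 6 * k ^ 8))"
      using eq unfolding k l by (simp add: power_mult_distrib)
    then have "x\<^sup>2 = 7 * (4 * 7 * l ^ 3 - 7 ^ 6 * k ^ 8)" by simp
    then have "7 dvd x\<^sup>2" by simp
    then have "7 dvd x" using p7 prime_dvd_power by blast
    with \<open>7 dvd y\<close> cop show False using p7 by (metis coprime_common_divisor not_prime_unit)
  qed
  have "(y ^ 4)\<^sup>2 + 7 * x\<^sup>2 = 4 * z ^ 3" using eq by simp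
  moreover have "coprime (y ^ 4) (7 * x)"
    using cop prime_imp_coprime[OF p7 y7] by (simp add: coprime_commute)
  ultimately obtain a b where 1: "4 * y ^ 4 = a * (a\<^sup>2 - 21 * b\<^sup>2)"
    and 2: "4 * x = b * (3 * a\<^sup>2 - 7 * b\<^sup>2)" and "even (a - b)"
    using square_plus_7_square_eq_4_cube[of "y ^ 4" x z] x y by auto
  \<comment> \<open>If \<open>a\<close> and \<open>b\<close> were both even, the cubic form would be
    divisible by 8, making \<open>y\<close> even.\<close>
  have "odd a"
  proof
    assume "even a"
    then have "even b" using \<open>even (a - b)\<close> by simp
    obtain k l where kl: "a = 2 * k" "b = 2 * l" using \<open>even a\<close> \<open>even b\<close> by (auto elim!: evenE)
    have "4 * y ^ 4 = 4 * (2 * (k * (k\<^sup>2 - 21 * l\<^sup>2)))"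
      unfolding 1 kl by (simp add: power_mult_distrib algebra_simps)
    then have "even (y ^ 4)" by simp
    then show False using y by simp
  qed
  moreover from this have "odd b" using \<open>even (a - b)\<close> by simp
  \<comment> \<open>A common divisor is odd and divides both 4y^4 and 4x, hence the coprime numbers
    y^4 and x.\<close>
  moreover have "coprime a b"
  proof (rule coprimeI)
    fix c assume c: "c dvd a" "c dvd b"
    have "odd c" using c(1) \<open>odd a\<close> dvd_trans by blast
    then have c4: "coprime c (2 ^ 2)"
      using coprime_power_2_odd[of c 2] coprime_commute by blast
    have "c dvd 2 ^ 2 * y ^ 4" "c dvd 2 ^ 2 * x" using c 1 2 by simp_all
    then have "c dvd y ^ 4" "c dvd x" using c4 coprime_dvd_mult_right_iff by blast+
    moreover have "coprime x (y ^ 4)" using cop by simp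
    ultimately show "is_unit c" using coprime_common_divisor by blast
  qed
  ultimately show False using no_solution_of_odd_coprime_cubic[OF 1] y y7 by blast
qed

end
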